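(* Cartan subalgebras of a Leibniz $n$-algebra are in general not conjugate: for every integer $n\ge 3$ there exists a finite-dimensional complex Leibniz $n$-algebra $L$ possessing two Cartan subalgebras of different dimensions; in particular, there are Cartan subalgebras $H,K$ of $L$ such that no automorphism of $L$ maps $K$ onto $H$.
   Context: A Leibniz $n$-algebra is a vector space $L$ with an $n$-linear multiplication $[-,\dots,-]:L^{\otimes n}\to L$ satisfying $[[x_1,\dots,x_n],y_2,\dots,y_n]=\sum_{i=1}^n[x_1,\dots,x_{i-1},[x_i,y_2,\dots,y_n],x_{i+1},\dots,x_n]$ for all elements. For a subspace $C\subseteq L$ the 1-normalizer is $N_1(C)=\{a\in L: [a,c_2,\dots,c_n]\in C \text{ for all } c_2,\dots,c_n\in C\}$. A Leibniz $n$-algebra $C$ is 1-nilpotent if the series $C^{<1>_1}=C$, $C^{<k+1>_1}=[C^{<k>_1},C,\dots,C]$ (linear span of such products) satisfies $C^{<k>_1}=0$ for some $k$. A Cartan subalgebra of $L$ is a subalgebra $C$ that is 1-nilpotent and satisfies $C=N_1(C)$. *)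

theory Defs
  imports Complex_Main "HOL-Library.Function_Algebras"
begin

(* The carrier of the algebra is a subspace L of an ambient vector space, so that algebras of
   varying dimension live in one type. An n-ary product is a function on lists; only its values
   on lists of length n over L are relevant, and xs[i := a] replaces the i-th argument
   (counting from 0). *)
locale leibniz_n_algebra = vector_space scale
  for scale :: "'k::field \<Rightarrow> 'v::ab_group_add \<Rightarrow> 'v" +
  fixes n :: nat and L :: "'v set" and bracket :: "'v list \<Rightarrow> 'v"
  assumes n_pos: "0 < n"
    and subspace_carrier: "subspace L"
    and bracket_closed: "length xs = n \<Longrightarrow> set xs \<subseteq> L \<Longrightarrow> bracket xs \<in> L"
    and bracket_add: "length xs = n \<Longrightarrow> set xs \<subseteq> L \<Longrightarrow> i < n \<Longrightarrow> a \<in> L \<Longrightarrow> b \<in> L \<Longrightarrow>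
      bracket (xs[i := a + b]) = bracket (xs[i := a]) + bracket (xs[i := b])"
    and bracket_scale: "length xs = n \<Longrightarrow> set xs \<subseteq> L \<Longrightarrow> i < n \<Longrightarrow> a \<in> L \<Longrightarrow>
      bracket (xs[i := scale c a]) = scale c (bracket (xs[i := a]))"
    and leibniz_identity: "length xs = n \<Longrightarrow> set xs \<subseteq> L \<Longrightarrow> length ys = n - 1 \<Longrightarrow> set ys \<subseteq> L \<Longrightarrow>
      bracket (bracket xs # ys) = (\<Sum>i<n. bracket (xs[i := bracket (xs ! i # ys)]))"
begin

definition finite_dimensional :: bool where
  "finite_dimensional \<longleftrightarrow> (\<exists>B. finite B \<and> span B = L)"

definition subalgebra :: "'v set \<Rightarrow> bool" where
  "subalgebra C \<longleftrightarrow> subspace C \<and> C \<subseteq> L \<and>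
    (\<forall>cs. length cs = n \<and> set cs \<subseteq> C \<longrightarrow> bracket cs \<in> C)"

definition normalizer1 :: "'v set \<Rightarrow> 'v set" where
  "normalizer1 C = {a \<in> L. \<forall>cs. length cs = n - 1 \<and> set cs \<subseteq> C \<longrightarrow> bracket (a # cs) \<in> C}"

(* The index is shifted by one: series1 C k is the (k+1)-st term of the series,
   which conventionally starts at 1. *)
primrec series1 :: "'v set \<Rightarrow> nat \<Rightarrow> 'v set" where
  "series1 C 0 = C"
| "series1 C (Suc k) =
    span {bracket (a # cs) | a cs. a \<in> series1 C k \<and> length cs = n - 1 \<and> set cs \<subseteq> C}"

definition nilpotent1 :: "'v set \<Rightarrow> bool" where
  "nilpotent1 C \<longleftrightarrow> (\<exists>k. series1 C k = {0})"

definition cartan_subalgebra :: "'v set \<Rightarrow> bool" where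
  "cartan_subalgebra C \<longleftrightarrow> subalgebra C \<and> nilpotent1 C \<and> C = normalizer1 C"

(* Values of f outside L are irrelevant. *)
definition automorphism :: "('v \<Rightarrow> 'v) \<Rightarrow> bool" where
  "automorphism f \<longleftrightarrow> bij_betw f L L \<and>
    (\<forall>a\<in>L. \<forall>b\<in>L. f (a + b) = f a + f b) \<and>
    (\<forall>c. \<forall>a\<in>L. f (scale c a) = scale c (f a)) \<and>
    (\<forall>xs. length xs = n \<and> set xs \<subseteq> L \<longrightarrow> f (bracket xs) = bracket (map f xs))"

end

(* Every finite-dimensional complex vector space is isomorphic to a subspace of the space of
   complex sequences, with pointwise operations. *)
definition seq_scale :: "complex \<Rightarrow> (nat \<Rightarrow> complex) \<Rightarrow> (nat \<Rightarrow> complex)" where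
  "seq_scale c v = (\<lambda>i. c * v i)"

interpretation seq: vector_space seq_scale
  by unfold_locales (auto simp: seq_scale_def algebra_simps fun_eq_iff)

end

(* Let two commuting diagonal operators D1 and D2 act on C^5, and put
   [x1,...,xn] = p(x2,...,xn) D1 x1 + q(x2,...,xn) D2 x1 for two (n-1)-linear forms p and q.
   The Leibniz identity holds as soon as p and q are annihilated by D1 and D2 acting as derivations.
   If p vanishes on ker D2 and q vanishes on ker D1, but neither vanishes on the other kernel,
   then ker D1 and ker D2 are Cartan subalgebras: on each of them the bracket is zero, and an
   element a is normalized into ker D1 only if D1 a lies in ker D1, that is, a lies in ker D1.
   Nothing prevents the kernels from having dimensions 2 and 3. A form such as
   p(x2,...,xn) = x2(1) x3(0) ... xn(0) is annihilated by D when the eigenvalues of D satisfy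
   d(1) + (n-2) d(0) = 0; since D2 must be injective on ker D1, both d(0) and d(1) have to be
   nonzero for D = D2, which is possible only for n at least 3. *)
theory Submission imports Defs begin

section \<open>Coordinate subspaces of the sequence space\<close>

definition coord_space :: "nat set \<Rightarrow> (nat \<Rightarrow> complex) set" where
  "coord_space S = {v. \<forall>t. t \<notin> S \<longrightarrow> v t = 0}"

definition unit_seq :: "nat \<Rightarrow> nat \<Rightarrow> complex" where
  "unit_seq i = (\<lambda>t. if t = i then 1 else 0)"

lemma unit_seq_in_coord_space: "i \<in> S \<Longrightarrow> unit_seq i \<in> coord_space S"
  by (auto simp: unit_seq_def coord_space_def)

lemma inj_unit_seq: "inj unit_seq"
  by (rule injI) (metis unit_seq_def zero_neq_one)

lemma coord_space_mono: "S \<subseteq> T \<Longrightarrow> coord_space S \<subseteq> coord_space T"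
  by (auto simp: coord_space_def)

lemma subspace_coord_space: "seq.subspace (coord_space S)"
  by (auto simp: seq.subspace_def coord_space_def seq_scale_def)

lemma sum_fun_apply: "(\<Sum>i\<in>A. f i) t = (\<Sum>i\<in>A. f i t)"
  for f :: "'a \<Rightarrow> 'b \<Rightarrow> 'c::comm_monoid_add"
  by (induction A rule: infinite_finite_induct) auto

lemma coord_space_expansion:
  assumes "finite S" "v \<in> coord_space S"
  shows "v = (\<Sum>i\<in>S. seq_scale (v i) (unit_seq i))"
proof
  fix t
  have "(\<Sum>i\<in>S. seq_scale (v i) (unit_seq i)) t = (\<Sum>i\<in>S. if t = i then v i else 0)"
    unfolding sum_fun_apply by (rule sum.cong) (auto simp: seq_scale_def unit_seq_def)
  then show "v t = (\<Sum>i\<in>S. seq_scale (v i) (unit_seq i)) t"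
    using assms by (auto simp: coord_space_def)
qed

lemma span_unit_seq:
  assumes "finite S"
  shows "seq.span (unit_seq ` S) = coord_space S"
proof
  show "seq.span (unit_seq ` S) \<subseteq> coord_space S"
    by (intro seq.span_minimal subspace_coord_space) (auto intro: unit_seq_in_coord_space)
  show "coord_space S \<subseteq> seq.span (unit_seq ` S)"
  proof
    fix v assume "v \<in> coord_space S"
    then have "v = (\<Sum>i\<in>S. seq_scale (v i) (unit_seq i))"
      by (rule coord_space_expansion[OF assms])
    also have "\<dots> \<in> seq.span (unit_seq ` S)"
      by (intro seq.span_sum seq.span_scale seq.span_base) auto
    finally show "v \<in> seq.span (unit_seq ` S)" .
  qed
qed

lemma independent_unit_seq: "finite S \<Longrightarrow> seq.independent (unit_seq ` S)"
proof (induction S rule: finite_induct)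
  case empty
  show ?case by (simp add: seq.independent_empty)
next
  case (insert i S)
  then have "unit_seq i \<notin> seq.span (unit_seq ` S)"
    unfolding span_unit_seq[OF insert.hyps(1)] by (auto simp: coord_space_def unit_seq_def)
  then show ?case
    using insert.IH by (simp add: seq.independent_insertI)
qed

lemma dim_coord_space:
  assumes "finite S"
  shows "seq.dim (coord_space S) = card S"
  by (metis assms card_image independent_unit_seq inj_on_subset inj_unit_seq seq.dim_eq_card
      seq.dim_span span_unit_seq subset_UNIV)

section \<open>Monomial forms and diagonal brackets\<close>

text \<open>Argument 0 of a bracket is the one acted on, so monomials involve the arguments from 1 on.\<close>

definition monomial_form :: "nat \<Rightarrow> (nat \<Rightarrow> nat) \<Rightarrow> (nat \<Rightarrow> complex) list \<Rightarrow> complex" where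
  "monomial_form n w xs = (\<Prod>i\<in>{1..<n}. (xs ! i) (w i))"

lemma monomial_form_update_0: "monomial_form n w (xs[0 := a]) = monomial_form n w xs"
  by (simp add: monomial_form_def)

lemma monomial_form_update:
  assumes "length xs = n" "i \<in> {1..<n}"
  shows "monomial_form n w (xs[i := a]) = a (w i) * (\<Prod>j\<in>{1..<n} - {i}. (xs ! j) (w j))"
proof -
  have "(\<Prod>j\<in>{1..<n} - {i}. (xs[i := a] ! j) (w j)) = (\<Prod>j\<in>{1..<n} - {i}. (xs ! j) (w j))"
    by (rule prod.cong) auto
  then show ?thesis
    unfolding monomial_form_def prod.remove[OF finite_atLeastLessThan assms(2)]
    using assms by simp
qed

text \<open>This makes the monomial a weight vector: a diagonal operator with eigenvalues
  \<open>c\<close>, acting as a derivation, multiplies it by the sum of the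
  \<open>c (w i)\<close>.\<close>

lemma monomial_form_update_mult:
  assumes "length xs = n" "i \<in> {1..<n}"
  shows "monomial_form n w (xs[i := (\<lambda>t. c t * (xs ! i) t)]) = c (w i) * monomial_form n w xs"
  using monomial_form_update[OF assms, of w] monomial_form_update[OF assms, of w "xs ! i"]
  by simp

lemma monomial_form_unit_seq:
  "monomial_form n w (a # map (\<lambda>i. unit_seq (w i)) [1..<n]) = 1"
  by (auto simp: monomial_form_def unit_seq_def nth_Cons' intro!: prod.neutral)

definition diag_bracket ::
  "nat \<Rightarrow> (nat \<Rightarrow> nat) \<Rightarrow> (nat \<Rightarrow> complex) \<Rightarrow> (nat \<Rightarrow> nat) \<Rightarrow> (nat \<Rightarrow> complex) \<Rightarrow>
    (nat \<Rightarrow> complex) list \<Rightarrow> (nat \<Rightarrow> complex)" where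
  "diag_bracket n u d w e xs =
    (\<lambda>t. (monomial_form n u xs * d t + monomial_form n w xs * e t) * (xs ! 0) t)"

text \<open>Right multiplication by \<open>ys\<close> is a diagonal operator, and the Leibniz
  identity says that it is a derivation of the bracket. The sums in \<open>inv\<close> are the
  weights of the two forms under \<open>d\<close> and \<open>e\<close>; as they vanish, the summands
  for the arguments from 1 on cancel.\<close>

lemma leibniz_n_algebra_diag_bracket:
  assumes n: "0 < n"
    and inv: "(\<Sum>i\<in>{1..<n}. d (u i)) = 0" "(\<Sum>i\<in>{1..<n}. d (w i)) = 0"
             "(\<Sum>i\<in>{1..<n}. e (u i)) = 0" "(\<Sum>i\<in>{1..<n}. e (w i)) = 0"
  shows "leibniz_n_algebra seq_scale n (coord_space T) (diag_bracket n u d w e)"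
proof unfold_locales
  fix xs :: "(nat \<Rightarrow> complex) list"
  assume len: "length xs = n" and sub: "set xs \<subseteq> coord_space T"
  have "xs ! 0 \<in> coord_space T"
    using len sub n by (metis nth_mem subsetD)
  then show "diag_bracket n u d w e xs \<in> coord_space T"
    by (auto simp: diag_bracket_def coord_space_def)
next
  fix xs :: "(nat \<Rightarrow> complex) list" and i :: nat and a b :: "nat \<Rightarrow> complex"
  assume len: "length xs = n" and "i < n"
  then consider "i = 0" | "i \<in> {1..<n}" by fastforce
  then show "diag_bracket n u d w e (xs[i := a + b]) =
    diag_bracket n u d w e (xs[i := a]) + diag_bracket n u d w e (xs[i := b])"
    using len n
    by cases (auto simp: diag_bracket_def monomial_form_update_0 monomial_form_update
        fun_eq_iff algebra_simps)
next
  fix xs :: "(nat \<Rightarrow> complex) list" and i :: nat and c :: complex and a :: "nat \<Rightarrow> complex"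
  assume len: "length xs = n" and "i < n"
  then consider "i = 0" | "i \<in> {1..<n}" by fastforce
  then show "diag_bracket n u d w e (xs[i := seq_scale c a]) =
    seq_scale c (diag_bracket n u d w e (xs[i := a]))"
    using len n
    by cases (auto simp: diag_bracket_def monomial_form_update_0 monomial_form_update
        seq_scale_def fun_eq_iff algebra_simps)
next
  fix xs ys :: "(nat \<Rightarrow> complex) list"
  assume len: "length xs = n"
  let ?br = "diag_bracket n u d w e"
  define P where "P a = monomial_form n u (a # ys)" for a
  define Q where "Q a = monomial_form n w (a # ys)" for a
  \<comment> \<open>The forms ignore argument 0, so \<open>0\<close> can stand for \<open>a\<close>;
    right multiplication by \<open>ys\<close> then has eigenvalues \<open>c\<close> that depend on
    \<open>ys\<close> alone.\<close>
  have PQ: "P a = P 0" "Q a = Q 0" for a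
    unfolding P_def Q_def using monomial_form_update_0[of _ _ "0 # ys" a] by simp_all
  define c where "c t = P 0 * d t + Q 0 * e t" for t
  have br_ys: "?br (a # ys) = (\<lambda>t. c t * a t)" for a
    using PQ[of a] by (simp add: diag_bracket_def c_def P_def Q_def)
  have inv_c: "(\<Sum>i\<in>{1..<n}. c (u i)) = 0" "(\<Sum>i\<in>{1..<n}. c (w i)) = 0"
    using inv by (simp_all add: c_def sum.distrib flip: sum_distrib_left)
  show "?br (?br xs # ys) = (\<Sum>i<n. ?br (xs[i := ?br (xs ! i # ys)]))"
  proof
    fix t
    let ?y = "\<lambda>i. ?br (xs[i := ?br (xs ! i # ys)]) t"
    let ?p = "monomial_form n u xs" and ?q = "monomial_form n w xs" and ?x = "(xs ! 0) t"
    have "?y i = (c (u i) * (?p * d t) + c (w i) * (?q * e t)) * ?x" if "i \<in> {1..<n}" for i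
      using that unfolding br_ys
      by (simp add: diag_bracket_def monomial_form_update_mult[OF len] mult.assoc)
    then have "(\<Sum>i\<in>{1..<n}. ?y i) =
        ((\<Sum>i\<in>{1..<n}. c (u i)) * (?p * d t) + (\<Sum>i\<in>{1..<n}. c (w i)) * (?q * e t)) * ?x"
      by (simp add: sum.distrib sum_distrib_right distrib_right)
    then have rest: "(\<Sum>i\<in>{1..<n}. ?y i) = 0"
      unfolding inv_c by simp
    have "(\<Sum>i<n. ?br (xs[i := ?br (xs ! i # ys)])) t = (\<Sum>i<n. ?y i)"
      by (rule sum_fun_apply)
    also have "\<dots> = ?y 0 + (\<Sum>i\<in>{1..<n}. ?y i)"
      using n by (simp add: lessThan_atLeast0 sum.atLeast_Suc_lessThan)
    \<comment> \<open>At \<open>i = 0\<close> the forms keep their values and diagonal operators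
      commute, so this summand is the left-hand side.\<close>
    also have "\<dots> = ?br (?br xs # ys) t"
      unfolding rest unfolding br_ys
      using len n by (simp add: diag_bracket_def monomial_form_update_0)
    finally show "?br (?br xs # ys) t = (\<Sum>i<n. ?br (xs[i := ?br (xs ! i # ys)])) t" ..
  qed
qed (use n subspace_coord_space in auto)

section \<open>Kernels of diagonal operators as Cartan subalgebras\<close>

text \<open>By \<open>ker\<close>, \<open>coord_space S\<close> is the kernel of the diagonal
  operator \<open>d\<close> on \<open>coord_space T\<close>, and by \<open>act\<close> its elements
  multiply from the right as multiples of \<open>d\<close>. So the bracket vanishes on it, and
  \<open>nonzero\<close> lets the scalar be cancelled in the normalizer condition.\<close>

lemma cartan_subalgebra_coord_space:
  assumes alg: "leibniz_n_algebra seq_scale n (coord_space T) br"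
    and S: "S \<subseteq> T"
    and act: "\<And>a cs. length cs = n - 1 \<Longrightarrow> set cs \<subseteq> coord_space S \<Longrightarrow>
      br (a # cs) = (\<lambda>t. p (a # cs) * d t * a t)"
    and ker: "\<And>t. t \<in> T \<Longrightarrow> d t = 0 \<longleftrightarrow> t \<in> S"
    and nonzero: "\<And>a. \<exists>cs. length cs = n - 1 \<and> set cs \<subseteq> coord_space S \<and> p (a # cs) \<noteq> 0"
  shows "leibniz_n_algebra.cartan_subalgebra seq_scale n (coord_space T) br (coord_space S)"
proof -
  interpret leibniz_n_algebra seq_scale n "coord_space T" br by (rule alg)
  let ?C = "coord_space S"
  have zero: "br (a # cs) = 0" if "a \<in> ?C" "length cs = n - 1" "set cs \<subseteq> ?C" for a cs
  proof -
    have "d t * a t = 0" for t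
      using that(1) ker S by (cases "t \<in> S") (auto simp: coord_space_def)
    then show ?thesis
      using act[OF that(2,3)] by (auto simp: fun_eq_iff mult.assoc)
  qed
  have "br cs \<in> ?C" if "length cs = n" "set cs \<subseteq> ?C" for cs
  proof -
    obtain a cs' where "cs = a # cs'"
      using \<open>length cs = n\<close> n_pos by (cases cs) auto
    then show ?thesis
      using zero[of a cs'] that seq.subspace_0[OF subspace_coord_space] by auto
  qed
  then have "subalgebra ?C"
    unfolding subalgebra_def using subspace_coord_space coord_space_mono[OF S] by blast
  moreover have "nilpotent1 ?C"
  proof -
    have "seq.span {br (a # cs) | a cs. a \<in> ?C \<and> length cs = n - 1 \<and> set cs \<subseteq> ?C}
        \<subseteq> seq.span {0}"
      by (rule seq.span_mono) (use zero in auto)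
    \<comment> \<open>By the index shift this is the second term of the series.\<close>
    then have "series1 ?C 1 = {0}"
      using seq.span_zero by auto
    then show ?thesis
      unfolding nilpotent1_def by blast
  qed
  moreover have "?C = normalizer1 ?C"
  proof
    show "?C \<subseteq> normalizer1 ?C"
      using zero coord_space_mono[OF S] seq.subspace_0[OF subspace_coord_space]
      by (auto simp: normalizer1_def)
    show "normalizer1 ?C \<subseteq> ?C"
    proof
      fix a assume a: "a \<in> normalizer1 ?C"
      obtain cs where cs: "length cs = n - 1" "set cs \<subseteq> ?C" "p (a # cs) \<noteq> 0"
        using nonzero by blast
      then have "(\<lambda>t. p (a # cs) * d t * a t) \<in> ?C"
        using a act[of cs a] unfolding normalizer1_def by fastforce
      \<comment> \<open>Off \<open>S\<close>, \<open>a\<close> vanishes for two reasons: inside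
        \<open>T\<close> because \<open>d t\<close> is nonzero there, outside \<open>T\<close>
        because \<open>a\<close> lies in the carrier.\<close>
      then have "d t * a t = 0" if "t \<notin> S" for t
        using that cs(3) by (auto simp: coord_space_def)
      moreover have "a t = 0" if "t \<notin> T" for t
        using a that unfolding normalizer1_def by (simp add: coord_space_def)
      ultimately have "a t = 0" if "t \<notin> S" for t
        using that ker by (metis mult_eq_0_iff)
      then show "a \<in> ?C"
        by (simp add: coord_space_def)
    qed
  qed
  ultimately show ?thesis
    unfolding cartan_subalgebra_def by blast
qed

text \<open>One factor kills the product: the one at index 1, which \<open>2 \<le> n\<close> puts
  into range.\<close>

lemma monomial_form_eq_0:
  assumes "2 \<le> n" "length cs = n - 1" "set cs \<subseteq> coord_space S" "w 1 \<notin> S"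
  shows "monomial_form n w (a # cs) = 0"
proof -
  have "cs ! 0 \<in> coord_space S"
    using assms(1-3) by (metis One_nat_def Suc_1 diff_is_0_eq not_less_eq_eq nth_mem
        subsetD zero_less_iff_neq_zero)
  then have "((a # cs) ! 1) (w 1) = 0"
    using assms(4) by (simp add: coord_space_def)
  then show ?thesis
    unfolding monomial_form_def using assms(1) by (intro prod_zero bexI[of _ 1]) auto
qed

text \<open>This symmetry lets one criterion serve both Cartan subalgebras.\<close>

lemma diag_bracket_commute: "diag_bracket n u d w e = diag_bracket n w e u d"
  by (simp add: diag_bracket_def fun_eq_iff add.commute)

text \<open>On arguments from \<open>coord_space S\<close> the condition on \<open>w 1\<close> kills
  the second summand, while the unit vectors at the indices \<open>u i\<close> give the first form
  the value 1.\<close>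

lemma cartan_subalgebra_diag_bracket:
  assumes alg: "leibniz_n_algebra seq_scale n (coord_space T) (diag_bracket n u d w e)"
    and n: "2 \<le> n"
    and S: "S \<subseteq> T" "\<And>i. u i \<in> S" "w 1 \<notin> S"
    and ker: "\<And>t. t \<in> T \<Longrightarrow> d t = 0 \<longleftrightarrow> t \<in> S"
  shows "leibniz_n_algebra.cartan_subalgebra seq_scale n (coord_space T)
    (diag_bracket n u d w e) (coord_space S)"
proof (rule cartan_subalgebra_coord_space[OF alg S(1), where p = "monomial_form n u" and d = d])
  fix a :: "nat \<Rightarrow> complex" and cs
  assume "length cs = n - 1" "set cs \<subseteq> coord_space S"
  then have "monomial_form n w (a # cs) = 0"
    using monomial_form_eq_0 n S(3) by blast
  then show "diag_bracket n u d w e (a # cs) = (\<lambda>t. monomial_form n u (a # cs) * d t * a t)"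
    by (simp add: diag_bracket_def)
next
  fix a :: "nat \<Rightarrow> complex"
  show "\<exists>cs. length cs = n - 1 \<and> set cs \<subseteq> coord_space S \<and> monomial_form n u (a # cs) \<noteq> 0"
    using S(2)
    by (intro exI[of _ "map (\<lambda>i. unit_seq (u i)) [1..<n]"])
      (auto simp: monomial_form_unit_seq[simplified] intro: unit_seq_in_coord_space)
qed (use ker in auto)

section \<open>Automorphisms and dimension\<close>

text \<open>\<open>f\<close> is constrained only on \<open>L\<close> and need not be linear on the
  ambient space, so the induction keeps every partial sum inside \<open>L\<close>.\<close>

lemma (in leibniz_n_algebra) automorphism_sum:
  assumes f: "automorphism f" and "finite S" and "\<And>i. i \<in> S \<Longrightarrow> b i \<in> L"
  shows "f (\<Sum>i\<in>S. scale (r i) (b i)) = (\<Sum>i\<in>S. scale (r i) (f (b i)))"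
  using assms(2,3)
proof (induction S rule: finite_induct)
  case empty
  have "f 0 = f (0 + 0)" by simp
  also have "\<dots> = f 0 + f 0"
    using f subspace_0[OF subspace_carrier] unfolding automorphism_def by blast
  finally show ?case by simp
next
  case (insert i S)
  have "scale (r i) (b i) \<in> L" "(\<Sum>i\<in>S. scale (r i) (b i)) \<in> L"
    using insert.prems subspace_carrier by (auto intro: subspace_sum subspace_scale)
  then show ?case
    using insert f unfolding automorphism_def by simp
qed

text \<open>The images of the unit vectors span the image. An upper bound suffices to keep the
  smaller Cartan subalgebra from being mapped onto the larger one.\<close>

lemma dim_automorphism_image_le:
  assumes "leibniz_n_algebra seq_scale n (coord_space T) br"
    and f: "leibniz_n_algebra.automorphism seq_scale n (coord_space T) br f"
    and S: "S \<subseteq> T" "finite S"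
  shows "seq.dim (f ` coord_space S) \<le> card S"
proof -
  interpret leibniz_n_algebra seq_scale n "coord_space T" br by fact
  let ?B = "(\<lambda>i. f (unit_seq i)) ` S"
  have "f v \<in> seq.span ?B" if "v \<in> coord_space S" for v
  proof -
    have "f v = (\<Sum>i\<in>S. seq_scale (v i) (f (unit_seq i)))"
      using automorphism_sum[OF f S(2), of unit_seq v] S(1)
        coord_space_expansion[OF S(2) that] unit_seq_in_coord_space by (metis subsetD)
    also have "\<dots> \<in> seq.span ?B"
      by (intro seq.span_sum seq.span_scale seq.span_base) auto
    finally show ?thesis .
  qed
  then have "seq.dim (f ` coord_space S) \<le> card ?B"
    using S(2) by (intro seq.dim_le_card) auto
  also have "\<dots> \<le> card S"
    using S(2) by (rule card_image_le)
  finally show ?thesis .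
qed

section \<open>The example with kernels of dimensions 2 and 3\<close>

theorem mainTheorem1:
  fixes n :: nat
  assumes "n \<ge> 3"
  shows "\<exists>(L :: (nat \<Rightarrow> complex) set) (br :: (nat \<Rightarrow> complex) list \<Rightarrow> (nat \<Rightarrow> complex)).
    leibniz_n_algebra seq_scale n L br \<and>
    leibniz_n_algebra.finite_dimensional seq_scale L \<and>
    (\<exists>H K.
      leibniz_n_algebra.cartan_subalgebra seq_scale n L br H \<and>
      leibniz_n_algebra.cartan_subalgebra seq_scale n L br K \<and>
      seq.dim H \<noteq> seq.dim K \<and>
      \<not> (\<exists>f. leibniz_n_algebra.automorphism seq_scale n L br f \<and> f ` K = H))"
proof -
  \<comment> \<open>Indices 0, 1 span the kernel of \<open>d\<close> and carry the form of
    \<open>u\<close>; 2, 3, 4 span the kernel of \<open>e\<close> in \<open>?L\<close>, and 2, 3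
    carry the form of \<open>w\<close>. Index 4 makes the dimensions differ. The eigenvalue
    \<open>- of_nat (n - 2)\<close> solves \<open>d 3 + of_nat (n - 2) * d 2 = 0\<close> and
    \<open>e 1 + of_nat (n - 2) * e 0 = 0\<close>.\<close>
  define u :: "nat \<Rightarrow> nat" where "u i = (if i = 1 then 1 else 0)" for i
  define w :: "nat \<Rightarrow> nat" where "w i = (if i = 1 then 3 else 2)" for i
  define d :: "nat \<Rightarrow> complex" where
    "d t = (if t \<in> {0, 1} then 0 else if t = 3 then - of_nat (n - 2) else 1)" for t
  define e :: "nat \<Rightarrow> complex" where
    "e t = (if t \<in> {2, 3, 4} then 0 else if t = 1 then - of_nat (n - 2) else 1)" for t
  define br where "br = diag_bracket n u d w e"
  let ?L = "coord_space {..<5}" and ?H = "coord_space {2, 3, 4}" and ?K = "coord_space {0, 1}"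
  have sum_weights: "(\<Sum>i\<in>{1..<n}. g (if i = 1 then a else b)) = g a + of_nat (n - 2) * g b"
    for g :: "nat \<Rightarrow> complex" and a b :: nat
  proof -
    have "(\<Sum>i\<in>{1..<n}. g (if i = 1 then a else b)) =
        g a + (\<Sum>i\<in>{2..<n}. g (if i = 1 then a else b))"
      using assms by (simp add: sum.atLeast_Suc_lessThan numeral_2_eq_2)
    also have "(\<Sum>i\<in>{2..<n}. g (if i = 1 then a else b)) = (\<Sum>i\<in>{2..<n}. g b)"
      by (rule sum.cong) auto
    finally show ?thesis by simp
  qed
  have alg: "leibniz_n_algebra seq_scale n ?L br"
    unfolding br_def
    by (rule leibniz_n_algebra_diag_bracket; (unfold u_def w_def sum_weights)?)
      (use assms in \<open>simp_all add: d_def e_def\<close>)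
  \<comment> \<open>Thus \<open>- of_nat (n - 2)\<close> is nonzero, which keeps index 3 out of the
    kernel of \<open>d\<close> and index 1 out of that of \<open>e\<close>.\<close>
  have n_neq_2: "(of_nat n :: complex) \<noteq> 2"
    using assms of_nat_eq_iff[of n 2, where ?'a = complex] by simp
  have K: "leibniz_n_algebra.cartan_subalgebra seq_scale n ?L br ?K"
    unfolding br_def
    by (rule cartan_subalgebra_diag_bracket[OF alg[unfolded br_def]])
      (use assms n_neq_2 in \<open>auto simp: u_def w_def d_def\<close>)
  have br_commute: "br = diag_bracket n w e u d"
    unfolding br_def by (rule diag_bracket_commute)
  have H: "leibniz_n_algebra.cartan_subalgebra seq_scale n ?L br ?H"
    unfolding br_commute
    by (rule cartan_subalgebra_diag_bracket[OF alg[unfolded br_commute]])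
      (use assms n_neq_2 in \<open>auto simp: u_def w_def e_def\<close>)
  have fin: "leibniz_n_algebra.finite_dimensional seq_scale ?L"
    unfolding leibniz_n_algebra.finite_dimensional_def[OF alg]
    using span_unit_seq[of "{..<5}"] by blast
  have dims: "seq.dim ?H = 3" "seq.dim ?K = 2"
    by (simp_all add: dim_coord_space)
  have "f ` ?K \<noteq> ?H" if "leibniz_n_algebra.automorphism seq_scale n ?L br f" for f
    using dim_automorphism_image_le[OF alg that, of "{0, 1}"] dims by auto
  then show ?thesis
    using alg fin H K dims by (intro exI[of _ ?L] exI[of _ br] conjI exI[of _ ?H] exI[of _ ?K]) auto
qed

end
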